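(* There exist a constant $c>0$ and an integer $N_0$ such that for every integer $N\ge N_0$, \[ \sup_{d\ge 2}\ \sup_{\rho\in \mathrm{BOS}_N^{(2)}(d)}\ \inf_{\tau\in \mathrm{SEP}_{\mathrm H}^{(2)}(d)}\ \|\rho-\tau\|_2\ \ge\ c\,N^{-1/2}. \]
   Context: $\mathrm D(\mathcal H)$ denotes the density operators on a finite-dimensional complex Hilbert space $\mathcal H$, and $\|X\|_2=\sqrt{\mathrm{Tr}(X^\dagger X)}$ is the Hilbert--Schmidt norm. $\mathrm{Sym}^N(\mathbb C^d)\subseteq(\mathbb C^d)^{\otimes N}$ is the symmetric subspace. For a state $\rho_N$ on $(\mathbb C^d)^{\otimes N}$, $\rho_N^{(2)}$ is its marginal on the first two tensor factors. $\mathrm{BOS}_N^{(2)}(d):=\{\rho_N^{(2)}:\rho_N\in\mathrm D(\mathrm{Sym}^N(\mathbb C^d))\}$. $\mathrm{SEP}_{\mathrm H}^{(2)}(d):=\mathrm{conv}\{(|u\rangle\langle u|)^{\otimes 2}:u\in\mathbb C^d,\ \|u\|=1\}$. *)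

theory Defs
  imports
    "HOL-Library.Extended_Real"
    "HOL-Combinatorics.Permutations"
    "Jordan_Normal_Form.Schur_Decomposition"
begin

text \<open>
  The space $(\mathbb{C}^d)^{\otimes N}$ is \<open>carrier_vec (d ^ N)\<close>. The basis vector
  $e_{a_0} \otimes \cdots \otimes e_{a_{N-1}}$ has index \<open>flat_index d N a\<close>: base \<open>d\<close>, the first
  tensor factor being the most significant digit.
\<close>

definition flat_index :: "nat \<Rightarrow> nat \<Rightarrow> (nat \<Rightarrow> nat) \<Rightarrow> nat" where
  "flat_index d N a = (\<Sum>k<N. a k * d ^ (N - 1 - k))"

definition mat_kron :: "complex mat \<Rightarrow> complex mat \<Rightarrow> complex mat" where
  "mat_kron A B = mat (dim_row A * dim_row B) (dim_col A * dim_col B)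
     (\<lambda>(i, j). A $$ (i div dim_row B, j div dim_col B) * B $$ (i mod dim_row B, j mod dim_col B))"

text \<open>Trace over the second factor of $\mathbb{C}^m \otimes \mathbb{C}^n$.\<close>

definition partial_trace :: "nat \<Rightarrow> nat \<Rightarrow> complex mat \<Rightarrow> complex mat" where
  "partial_trace m n A = mat m m (\<lambda>(i, j). \<Sum>k<n. A $$ (i * n + k, j * n + k))"

text \<open>
  \<open>mat_kron\<close> and \<open>partial_trace\<close> agree with \<open>flat_index\<close> on how a system of \<open>m + n\<close> factors
  splits into its first \<open>m\<close> and last \<open>n\<close> factors.
\<close>

lemma flat_index_split:
  "flat_index d (m + n) a = flat_index d m a * d ^ n + flat_index d n (\<lambda>k. a (m + k))"
proof -
  have split: "(\<Sum>k<m + n. f k) = (\<Sum>k<m. f k) + (\<Sum>k<n. f (m + k))" for f :: "nat \<Rightarrow> nat"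
    by (induction n) auto
  have "flat_index d (m + n) a =
      (\<Sum>k<m. a k * d ^ (m + n - 1 - k)) + (\<Sum>k<n. a (m + k) * d ^ (m + n - 1 - (m + k)))"
    unfolding flat_index_def by (rule split)
  also have "(\<Sum>k<m. a k * d ^ (m + n - 1 - k)) = flat_index d m a * d ^ n"
    unfolding flat_index_def sum_distrib_right
    by (rule sum.cong) (auto simp: power_add[symmetric] mult.assoc intro!: arg_cong[of _ _ "power d"])
  also have "(\<Sum>k<n. a (m + k) * d ^ (m + n - 1 - (m + k))) = flat_index d n (\<lambda>k. a (m + k))"
    unfolding flat_index_def by (rule sum.cong) auto
  finally show ?thesis .
qed

definition sym_subspace :: "nat \<Rightarrow> nat \<Rightarrow> complex vec set" where
  "sym_subspace d N = {v \<in> carrier_vec (d ^ N). \<forall>a \<pi>. (\<forall>k<N. a k < d) \<longrightarrow> \<pi> permutes {..<N} \<longrightarrow>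
     v $ flat_index d N (a \<circ> \<pi>) = v $ flat_index d N a}"

definition mat_trace :: "complex mat \<Rightarrow> complex" where
  "mat_trace A = (\<Sum>i<dim_row A. A $$ (i, i))"

definition hs_norm :: "complex mat \<Rightarrow> real" where
  "hs_norm A = sqrt (Re (mat_trace (mat_adjoint A * A)))"

definition l2_norm :: "complex vec \<Rightarrow> real" where
  "l2_norm v = sqrt (Re (v \<bullet>c v))"

text \<open>
  Density operators on a subspace \<open>V\<close> of $\mathbb{C}^n$, extended by zero on the orthogonal
  complement of \<open>V\<close>. For a Hermitian matrix, having range in \<open>V\<close> forces it to vanish there.
\<close>

definition density_ops :: "nat \<Rightarrow> complex vec set \<Rightarrow> complex mat set" where
  "density_ops n V = {\<rho> \<in> carrier_mat n n.
     mat_adjoint \<rho> = \<rho> \<and>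
     (\<forall>v \<in> carrier_vec n. 0 \<le> Re ((\<rho> *\<^sub>v v) \<bullet>c v)) \<and>
     mat_trace \<rho> = 1 \<and>
     (\<forall>v \<in> carrier_vec n. \<rho> *\<^sub>v v \<in> V)}"

text \<open>Meaningful for \<open>N \<ge> 2\<close> only.\<close>

definition BOS2 :: "nat \<Rightarrow> nat \<Rightarrow> complex mat set" where
  "BOS2 N d = partial_trace (d ^ 2) (d ^ (N - 2)) ` density_ops (d ^ N) (sym_subspace d N)"

definition ket_bra :: "complex vec \<Rightarrow> complex mat" where
  "ket_bra u = mat (dim_vec u) (dim_vec u) (\<lambda>(i, j). u $ i * cnj (u $ j))"

text \<open>
  The matrix type is not a real vector space (its dimensions are not part of the type), so the
  library's \<open>convex hull\<close> does not apply to it.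
\<close>

definition mat_convex_hull :: "nat \<Rightarrow> complex mat set \<Rightarrow> complex mat set" where
  "mat_convex_hull n S = {mat n n (\<lambda>(i, j). \<Sum>A\<in>T. of_real (w A) * A $$ (i, j)) |T w.
     finite T \<and> T \<subseteq> S \<and> (\<forall>A\<in>T. 0 \<le> w A) \<and> sum w T = (1::real)}"

definition SEP_H2 :: "nat \<Rightarrow> complex mat set" where
  "SEP_H2 d = mat_convex_hull (d ^ 2)
     {mat_kron (ket_bra u) (ket_bra u) |u. u \<in> carrier_vec d \<and> l2_norm u = 1}"

end

(* The witness is the sum of the entries (00, ii) of a two-body matrix over i = 1, ..., d - 1.
   On a product (|u><u|)^{(x)2} its real part is at most |u_0|^2 (1 - |u_0|^2) <= 1/4, while by
   Cauchy-Schwarz it is at most sqrt(d - 1) times the Hilbert-Schmidt norm. Take the bosonic pure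
   state that superposes, with equal weight, the uniform combinations of the words in which every
   nonzero letter occurs an even number of times and the letter 0 occurs z, respectively z - 2,
   times, where z is about N/2. Counting in two ways the words of each class that start with 00
   and with ii shows that the witness of its marginal is of order sqrt(d / N), hence at least 1/2
   for d = 12 N + 1. *)

theory Submission
  imports Defs "HOL-Analysis.Convex"
begin

section \<open>Words and their base-\<open>d\<close> indices\<close>

lemma flat_index_Suc: "flat_index d (Suc n) a = flat_index d n a * d + a n"
  using flat_index_split[of d n 1 a] by (simp add: flat_index_def)

lemma flat_index_less: "\<lbrakk>\<And>k. k < n \<Longrightarrow> a k < d\<rbrakk> \<Longrightarrow> flat_index d n a < d ^ n"
proof (induction n)
  case 0
  show ?case by (simp add: flat_index_def)
next
  case (Suc n)
  have "flat_index d n a + 1 \<le> d ^ n" using Suc by (simp add: Suc_leI)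
  then have "(flat_index d n a + 1) * d \<le> d ^ n * d" by (rule mult_le_mono1)
  moreover have "a n < d" using Suc.prems by simp
  ultimately show ?case by (simp add: flat_index_Suc algebra_simps)
qed

lemma flat_index_inj:
  assumes "flat_index d n a = flat_index d n b"
    and "\<And>k. k < n \<Longrightarrow> a k < d" "\<And>k. k < n \<Longrightarrow> b k < d" "k < n"
  shows "a k = b k"
  using assms
proof (induction n)
  case (Suc n)
  have an: "a n < d" and bn: "b n < d" using Suc.prems by auto
  have eq: "flat_index d n a * d + a n = flat_index d n b * d + b n"
    using Suc.prems(1) by (simp add: flat_index_Suc)
  have "(flat_index d n a * d + a n) mod d = a n" "(flat_index d n b * d + b n) mod d = b n"
    using an bn by auto
  with eq have "a n = b n" by simp
  moreover have "flat_index d n a = flat_index d n b" using eq calculation an by simp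
  ultimately show ?case using Suc by (cases "k = n") auto
qed simp

lemma flat_index_cong: "(\<And>k. k < n \<Longrightarrow> a k = b k) \<Longrightarrow> flat_index d n a = flat_index d n b"
  unfolding flat_index_def by (rule sum.cong) auto

text \<open>Extensional functions, so that a word is determined by its letters at positions below
  \<open>N\<close>. This makes the set finite and the index map injective on it.\<close>

definition words :: "nat \<Rightarrow> nat \<Rightarrow> (nat \<Rightarrow> nat) set" where
  "words d N = (\<Pi>\<^sub>E k\<in>{..<N}. {..<d})"

lemma finite_words: "finite (words d N)"
  unfolding words_def by (intro finite_PiE) auto

lemma words_less: "a \<in> words d N \<Longrightarrow> k < N \<Longrightarrow> a k < d"
  unfolding words_def by (auto simp: PiE_iff)

lemma words_comp_permutes:
  assumes "a \<in> words d N" "\<pi> permutes {..<N}"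
  shows "a \<circ> \<pi> \<in> words d N"
  using assms permutes_in_image[OF assms(2)] permutes_not_in[OF assms(2)]
  unfolding words_def PiE_iff extensional_def by fastforce

lemma inj_on_flat_index: "inj_on (flat_index d N) (words d N)"
proof (rule inj_onI)
  fix a b assume ab: "a \<in> words d N" "b \<in> words d N" "flat_index d N a = flat_index d N b"
  have "a k = b k" if "k < N" for k
    using flat_index_inj[OF ab(3) words_less[OF ab(1)] words_less[OF ab(2)] that] .
  then show "a = b"
    using ab(1,2) unfolding words_def by (intro PiE_ext) auto
qed

section \<open>Double counting over ordered pairs of positions\<close>

lemma exists_permutes_pair:
  fixes x y N :: nat
  assumes "x < N" "y < N" "x \<noteq> y"
  shows "\<exists>\<pi>. \<pi> permutes {..<N} \<and> \<pi> 0 = x \<and> \<pi> 1 = y"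
proof -
  \<comment> \<open>\<open>y'\<close> is the preimage of \<open>y\<close> under the swap of 0 and
    \<open>x\<close>. It differs from 0 because \<open>x\<close> and \<open>y\<close> differ, so
    swapping 1 with \<open>y'\<close> first leaves 0 alone.\<close>
  define y' where "y' = Transposition.transpose 0 x y"
  have y': "y' < N" "y' \<noteq> 0" using assms by (auto simp: y'_def transpose_def)
  define \<pi> where "\<pi> = Transposition.transpose 0 x \<circ> Transposition.transpose 1 y'"
  have "\<pi> permutes {..<N}" unfolding \<pi>_def using assms y'
    by (intro permutes_compose permutes_swap_id) auto
  moreover have "\<pi> 0 = x" using y' by (simp add: \<pi>_def transpose_def)
  moreover have "\<pi> 1 = y" by (simp add: \<pi>_def y'_def)
  ultimately show ?thesis by blast
qed

text \<open>Count the incidences of words with ordered pairs of distinct positions satisfying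
  \<open>P\<close>. By permutation invariance every pair of positions meets as many words as the
  pair (0, 1), and there are \<open>N * (N - 1)\<close> pairs; the right side counts word by
  word.\<close>

lemma card_pair_predicate:
  fixes A :: "(nat \<Rightarrow> nat) set"
  assumes fin: "finite A"
    and closed: "\<And>a \<pi>. a \<in> A \<Longrightarrow> \<pi> permutes {..<N} \<Longrightarrow> a \<circ> \<pi> \<in> A"
  shows "N * (N - 1) * card {a\<in>A. P (a 0) (a 1)} =
    (\<Sum>a\<in>A. card {(x, y). x < N \<and> y < N \<and> x \<noteq> y \<and> P (a x) (a y)})"
proof -
  define D where "D = (SIGMA x:{..<N}. {..<N} - {x})"
  have finD: "finite D" by (auto simp: D_def)
  have cardD: "card D = N * (N - 1)"
    unfolding D_def by (subst card_SigmaI) auto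
  have eq: "card {a\<in>A. P (a (fst p)) (a (snd p))} = card {a\<in>A. P (a 0) (a 1)}" if p: "p \<in> D" for p
  proof -
    obtain x y where xy: "p = (x, y)" "x < N" "y < N" "x \<noteq> y"
      using p by (auto simp: D_def)
    obtain \<pi> where \<pi>: "\<pi> permutes {..<N}" "\<pi> 0 = x" "\<pi> 1 = y"
      using exists_permutes_pair xy by blast
    have i: "inv_into UNIV \<pi> permutes {..<N}" using \<pi>(1) by (rule permutes_inv)
    \<comment> \<open>Composition with \<open>\<pi>\<close> moves the letters at \<open>x\<close>
      and \<open>y\<close> to the first two positions.\<close>
    have "bij_betw (\<lambda>a. a \<circ> \<pi>) {a\<in>A. P (a x) (a y)} {a\<in>A. P (a 0) (a 1)}"
    proof (rule bij_betw_byWitness[where f' = "\<lambda>a. a \<circ> inv_into UNIV \<pi>"])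
      have inv_x: "inv_into UNIV \<pi> x = 0" "inv_into UNIV \<pi> y = 1"
        using \<pi> permutes_inverses(2)[OF \<pi>(1)] by metis+
      show "(\<lambda>a. a \<circ> inv_into UNIV \<pi>) ` {a \<in> A. P (a 0) (a 1)} \<subseteq> {a \<in> A. P (a x) (a y)}"
        using closed[OF _ i] inv_x by auto
      show "(\<lambda>a. a \<circ> \<pi>) ` {a \<in> A. P (a x) (a y)} \<subseteq> {a \<in> A. P (a 0) (a 1)}"
        using closed[OF _ \<pi>(1)] \<pi>(2,3) by auto
    qed (use permutes_inv_o[OF \<pi>(1)] in \<open>auto simp: o_assoc[symmetric]\<close>)
    then show ?thesis by (simp add: xy(1) bij_betw_same_card)
  qed
  have "N * (N - 1) * card {a\<in>A. P (a 0) (a 1)} =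
      (\<Sum>p\<in>D. card {a\<in>A. P (a (fst p)) (a (snd p))})"
    by (simp add: eq cardD)
  also have "\<dots> = (\<Sum>a\<in>A. card {p\<in>D. P (a (fst p)) (a (snd p))})"
    using sum_multicount_gen[OF finD fin, where R = "\<lambda>p a. P (a (fst p)) (a (snd p))"
        and k = "\<lambda>a. card {p\<in>D. P (a (fst p)) (a (snd p))}"] by auto
  also have "\<dots> = (\<Sum>a\<in>A. card {(x, y). x < N \<and> y < N \<and> x \<noteq> y \<and> P (a x) (a y)})"
    by (intro sum.cong refl arg_cong[of _ _ card]) (auto simp: D_def)
  finally show ?thesis .
qed

section \<open>Words whose nonzero letters all occur evenly often\<close>

definition letter_count :: "nat \<Rightarrow> (nat \<Rightarrow> nat) \<Rightarrow> nat \<Rightarrow> nat" where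
  "letter_count N a i = card {k. k < N \<and> a k = i}"

definition even_words :: "nat \<Rightarrow> nat \<Rightarrow> nat \<Rightarrow> (nat \<Rightarrow> nat) set" where
  "even_words d N z = {a \<in> words d N. letter_count N a 0 = z \<and> (\<forall>i>0. even (letter_count N a i))}"

lemma letter_count_permutes:
  assumes "\<pi> permutes {..<N}"
  shows "letter_count N (a \<circ> \<pi>) i = letter_count N a i"
proof -
  have "bij_betw \<pi> {k. k < N \<and> (a \<circ> \<pi>) k = i} {k. k < N \<and> a k = i}"
  proof (rule bij_betw_byWitness[where f' = "inv_into UNIV \<pi>"])
    have i: "inv_into UNIV \<pi> permutes {..<N}" using assms by (rule permutes_inv)
    show "inv_into UNIV \<pi> ` {k. k < N \<and> a k = i} \<subseteq> {k. k < N \<and> (a \<circ> \<pi>) k = i}"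
      using permutes_in_image[OF i] permutes_inverses[OF assms] by auto
    show "\<pi> ` {k. k < N \<and> (a \<circ> \<pi>) k = i} \<subseteq> {k. k < N \<and> a k = i}"
      using permutes_in_image[OF assms] by auto
  qed (use permutes_inverses[OF assms] in auto)
  then show ?thesis unfolding letter_count_def by (rule bij_betw_same_card)
qed

lemma even_words_permutes:
  "a \<in> even_words d N z \<Longrightarrow> \<pi> permutes {..<N} \<Longrightarrow> a \<circ> \<pi> \<in> even_words d N z"
  by (simp add: even_words_def words_comp_permutes letter_count_permutes)

lemma finite_even_words: "finite (even_words d N z)"
  unfolding even_words_def using finite_words by auto

lemma even_words_subset: "even_words d N z \<subseteq> words d N"
  by (auto simp: even_words_def)

text \<open>The subtraction is never truncated, since positions 0 and 1 both carry \<open>j\<close>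
  before the update.\<close>

lemma letter_count_upd:
  assumes "2 \<le> N" "a 0 = j" "a 1 = j" "i \<noteq> j"
  shows "letter_count N (a(0 := i, 1 := i)) l =
    (if l = i then letter_count N a l + 2 else if l = j then letter_count N a l - 2 else letter_count N a l)"
proof -
  \<comment> \<open>The positions from 2 onward, which the update leaves untouched, are counted
    separately from the first two.\<close>
  define S where "S = {k. k < N \<and> 2 \<le> k \<and> a k = l}"
  have S: "finite S" "0 \<notin> S" "1 \<notin> S" by (auto simp: S_def)
  have c: "{k. k < N \<and> b k = l} = S \<union> (if b 0 = l then {0} else {}) \<union> (if b 1 = l then {1} else {})"
    if b: "\<And>k. 2 \<le> k \<Longrightarrow> b k = a k" for b
  proof (rule Set.set_eqI)
    fix k :: nat
    consider "k = 0" | "k = 1" | "2 \<le> k" by linarith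
    then show "k \<in> {k. k < N \<and> b k = l} \<longleftrightarrow>
        k \<in> S \<union> (if b 0 = l then {0} else {}) \<union> (if b 1 = l then {1} else {})"
      using assms(1) b[of k] by cases (auto simp: S_def)
  qed
  have cb: "letter_count N b l = card S + (if b 0 = l then 1 else 0) + (if b 1 = l then 1 else 0)"
    if "\<And>k. 2 \<le> k \<Longrightarrow> b k = a k" for b
  proof -
    have "letter_count N b l = card (S \<union> (if b 0 = l then {0} else {}) \<union> (if b 1 = l then {1} else {}))"
      unfolding letter_count_def by (rule arg_cong[of _ _ card], rule c, rule that)
    then show ?thesis using S by auto
  qed
  show ?thesis using assms cb[of a] cb[of "a(0 := i, 1 := i)"] by auto
qed

lemma even_words_raise:
  assumes "2 \<le> N" "a \<in> even_words d N z" "a 0 = 0" "a 1 = 0" "0 < i" "i < d"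
  shows "a(0 := i, 1 := i) \<in> even_words d N (z - 2)"
proof -
  have "a(0 := i, 1 := i) \<in> words d N"
    using assms unfolding even_words_def words_def PiE_iff extensional_def by auto
  moreover have "letter_count N (a(0 := i, 1 := i)) l = (if l = i then letter_count N a l + 2
      else if l = 0 then letter_count N a l - 2 else letter_count N a l)" for l
    by (rule letter_count_upd) (use assms in auto)
  ultimately show ?thesis using assms unfolding even_words_def by auto
qed

lemma even_words_lower:
  assumes "2 \<le> N" "a \<in> even_words d N z" "a 0 = i" "a 1 = i" "0 < i"
  shows "a(0 := 0, 1 := 0) \<in> even_words d N (z + 2)"
proof -
  have "i < d" using assms words_less[of a d N 0] by (auto simp: even_words_def)
  then have "a(0 := 0, 1 := 0) \<in> words d N"
    using assms unfolding even_words_def words_def PiE_iff extensional_def by auto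
  moreover have "letter_count N (a(0 := 0, 1 := 0)) l = (if l = 0 then letter_count N a l + 2
      else if l = i then letter_count N a l - 2 else letter_count N a l)" for l
    by (rule letter_count_upd) (use assms in auto)
  ultimately show ?thesis using assms unfolding even_words_def by auto
qed

section \<open>Counting even words by their first two letters\<close>

lemma card_even_words_zero_pair:
  "N * (N - 1) * card {a\<in>even_words d N z. a 0 = 0 \<and> a 1 = 0} = z * (z - 1) * card (even_words d N z)"
proof -
  have "card {(x, y). x < N \<and> y < N \<and> x \<noteq> y \<and> a x = 0 \<and> a y = 0} = z * (z - 1)"
    if "a \<in> even_words d N z" for a
  proof -
    define Z where "Z = {k. k < N \<and> a k = 0}"
    have Z: "finite Z" "card Z = z" using that by (auto simp: Z_def even_words_def letter_count_def)
    have "{(x, y). x < N \<and> y < N \<and> x \<noteq> y \<and> a x = 0 \<and> a y = 0} = (SIGMA x:Z. Z - {x})"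
      by (auto simp: Z_def)
    then show ?thesis using Z by (simp add: card_SigmaI)
  qed
  then show ?thesis
    using card_pair_predicate[of "even_words d N z" N "\<lambda>p q. p = 0 \<and> q = 0"]
      finite_even_words even_words_permutes by simp
qed

text \<open>This is where evenness enters: a nonzero letter that occurs at all occurs at least
  twice, so each of the \<open>N - z\<close> nonzero positions has a partner with the same
  letter.\<close>

lemma card_even_words_equal_pair:
  "N * (N - 1) * card {a\<in>even_words d N z. a 0 = a 1 \<and> 0 < a 0} \<ge> (N - z) * card (even_words d N z)"
proof -
  have "card {(x, y). x < N \<and> y < N \<and> x \<noteq> y \<and> a x = a y \<and> 0 < a x} \<ge> N - z" (is "card ?D \<ge> _")
    if a: "a \<in> even_words d N z" for a
  proof -
    define Z where "Z = {k. k < N \<and> a k = 0}"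
    have Z: "finite Z" "card Z = z" "Z \<subseteq> {..<N}"
      using a by (auto simp: Z_def even_words_def letter_count_def)
    have fin: "finite ?D" by (rule finite_subset[of _ "{..<N} \<times> {..<N}"]) auto
    have "{..<N} - Z \<subseteq> fst ` ?D"
    proof
      fix x assume "x \<in> {..<N} - Z"
      then have x: "x < N" "0 < a x" by (auto simp: Z_def)
      let ?S = "{k. k < N \<and> a k = a x}"
      have "even (card ?S)" using a x by (auto simp: even_words_def letter_count_def)
      \<comment> \<open>A singleton has odd cardinality.\<close>
      then have "?S \<noteq> {x}" by (metis is_singletonI is_singleton_altdef odd_one)
      then obtain y where "y \<in> ?S" "y \<noteq> x" using x by blast
      then have "(x, y) \<in> ?D" using x by auto
      then show "x \<in> fst ` ?D" by force
    qed
    then have "card ({..<N} - Z) \<le> card ?D"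
      using fin by (meson card_image_le card_mono finite_imageI le_trans)
    then show ?thesis using Z by (simp add: card_Diff_subset)
  qed
  then have "(\<Sum>a\<in>even_words d N z. N - z) \<le>
      (\<Sum>a\<in>even_words d N z. card {(x, y). x < N \<and> y < N \<and> x \<noteq> y \<and> a x = a y \<and> 0 < a x})"
    by (rule sum_mono)
  then show ?thesis
    using card_pair_predicate[of "even_words d N z" N "\<lambda>p q. p = q \<and> 0 < p"]
      finite_even_words even_words_permutes by (simp add: mult.commute)
qed

text \<open>Turning the leading pair 00 into \<open>ii\<close> is a bijection between the two
  classes once \<open>i\<close> is recorded; the inverse reads \<open>i\<close> off position 0. The
  \<open>d - 1\<close> choices of \<open>i\<close> give the factor that later makes a large
  dimension useful.\<close>

lemma card_even_words_exchange:
  assumes "2 \<le> N" "2 \<le> z"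
  shows "card {a\<in>even_words d N (z - 2). a 0 = a 1 \<and> 0 < a 0} =
    (d - 1) * card {a\<in>even_words d N z. a 0 = 0 \<and> a 1 = 0}"
proof -
  have z: "z - 2 + 2 = z" using assms by simp
  have "bij_betw (\<lambda>(i, a). a(0 := i, 1 := i)) ({1..<d} \<times> {a\<in>even_words d N z. a 0 = 0 \<and> a 1 = 0})
      {a\<in>even_words d N (z - 2). a 0 = a 1 \<and> 0 < a 0}"
  proof (rule bij_betw_byWitness[where f' = "\<lambda>a. (a 0, a(0 := 0, 1 := 0))"])
    show "(\<lambda>(i, a). a(0 := i, 1 := i)) ` ({1..<d} \<times> {a\<in>even_words d N z. a 0 = 0 \<and> a 1 = 0})
        \<subseteq> {a\<in>even_words d N (z - 2). a 0 = a 1 \<and> 0 < a 0}"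
      using even_words_raise[OF assms(1)] by auto
    show "(\<lambda>a. (a 0, a(0 := 0, 1 := 0))) ` {a\<in>even_words d N (z - 2). a 0 = a 1 \<and> 0 < a 0}
        \<subseteq> {1..<d} \<times> {a\<in>even_words d N z. a 0 = 0 \<and> a 1 = 0}"
    proof safe
      fix a assume a: "a \<in> even_words d N (z - 2)" "a 0 = a 1" "0 < a 0"
      show "a 0 \<in> {1..<d}" using a words_less[of a d N 0] assms by (auto simp: even_words_def)
      show "a(0 := 0, 1 := 0) \<in> even_words d N z"
        using even_words_lower[OF assms(1) a(1) refl] a z by auto
    qed auto
  qed (auto simp: fun_eq_iff)
  then show ?thesis using bij_betw_same_card by (fastforce simp: card_cartesian_product)
qed

lemma even_words_nonempty:
  assumes "2 * k \<le> N" "2 \<le> d"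
  shows "even_words d N (N - 2 * k) \<noteq> {}"
proof -
  \<comment> \<open>The letter 1 in the first \<open>2 * k\<close> positions, followed by zeros;
    \<open>2 <= d\<close> makes the letter 1 available.\<close>
  define a where "a = (\<lambda>j\<in>{..<N}. if j < 2 * k then 1 else 0 :: nat)"
  have "a \<in> words d N" using assms by (auto simp: words_def a_def)
  moreover have "{j. j < N \<and> a j = 0} = {2 * k..<N}" by (auto simp: a_def)
  then have "letter_count N a 0 = N - 2 * k" by (simp add: letter_count_def)
  moreover have "even (letter_count N a i)" if "0 < i" for i
  proof (cases "i = 1")
    case True
    have "{j. j < N \<and> a j = 1} = {..<2 * k}" using assms by (auto simp: a_def split: if_splits)
    then show ?thesis by (simp add: letter_count_def True)
  next
    case False
    have "{j. j < N \<and> a j = i} = {}" using False that by (auto simp: a_def split: if_splits)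
    then show ?thesis by (metis letter_count_def card.empty even_zero)
  qed
  ultimately show ?thesis unfolding even_words_def by blast
qed

lemma even_words_disjoint: "z \<noteq> z' \<Longrightarrow> even_words d N z \<inter> even_words d N z' = {}"
  by (auto simp: even_words_def)

text \<open>\<open>sym_subspace\<close> quantifies over arbitrary functions while words are
  extensional. Restricting to the positions below \<open>N\<close> passes from one to the other
  without changing the index.\<close>

lemma flat_index_even_words_iff:
  assumes "\<And>k. k < N \<Longrightarrow> a k < d"
  shows "flat_index d N a \<in> flat_index d N ` even_words d N z \<longleftrightarrow> restrict a {..<N} \<in> even_words d N z"
proof -
  have r: "restrict a {..<N} \<in> words d N" using assms by (auto simp: words_def)
  have "flat_index d N a = flat_index d N (restrict a {..<N})"
    by (rule flat_index_cong) simp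
  then show ?thesis
    using r inj_on_image_mem_iff[OF inj_on_flat_index r even_words_subset] by simp
qed

text \<open>Membership depends only on the letter counts, which permutations preserve. This is what
  puts the state into the symmetric subspace.\<close>

lemma flat_index_even_words_permutes:
  assumes "\<And>k. k < N \<Longrightarrow> a k < d" "\<pi> permutes {..<N}"
  shows "flat_index d N (a \<circ> \<pi>) \<in> flat_index d N ` even_words d N z \<longleftrightarrow>
    flat_index d N a \<in> flat_index d N ` even_words d N z"
proof -
  have 1: "(a \<circ> \<pi>) k < d" if "k < N" for k
    using assms that permutes_in_image[OF assms(2)] by auto
  have lc: "letter_count N (restrict b {..<N}) i = letter_count N b i" for b i
    unfolding letter_count_def by (intro arg_cong[of _ _ card]) auto
  have iff: "flat_index d N b \<in> flat_index d N ` even_words d N z \<longleftrightarrow>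
      letter_count N b 0 = z \<and> (\<forall>i>0. even (letter_count N b i))"
    if b: "\<And>k. k < N \<Longrightarrow> b k < d" for b
  proof -
    have "restrict b {..<N} \<in> words d N" using b by (auto simp: words_def)
    then have "restrict b {..<N} \<in> even_words d N z \<longleftrightarrow>
        letter_count N b 0 = z \<and> (\<forall>i>0. even (letter_count N b i))"
      by (simp add: even_words_def lc)
    then show ?thesis using flat_index_even_words_iff[of N b d z] b by simp
  qed
  show ?thesis
    using iff[of a] iff[of "a \<circ> \<pi>"] 1 assms(1) by (simp add: letter_count_permutes[OF assms(2)])
qed

section \<open>The Hilbert-Schmidt norm and the witness on separable states\<close>

lemma hs_norm_alt:
  assumes "C \<in> carrier_mat n n"
  shows "hs_norm C = sqrt (\<Sum>i<n. \<Sum>j<n. (cmod (C $$ (j, i)))\<^sup>2)"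
proof -
  have "Re (mat_trace (mat_adjoint C * C)) = (\<Sum>i<n. \<Sum>j<n. (cmod (C $$ (j, i)))\<^sup>2)"
    using assms unfolding mat_trace_def
    by (auto simp: mat_adjoint_def scalar_prod_def mat_of_rows_def lessThan_atLeast0
      cmod_power2 sum.distrib
      power2_eq_square[of "Re z" for z] power2_eq_square[of "Im z" for z] intro!: sum.cong)
  then show ?thesis by (simp add: hs_norm_def)
qed

text \<open>Cauchy-Schwarz for \<open>card J\<close> entries of a single row, whose squared moduli
  are part of the squared norm.\<close>

lemma hs_norm_ge_row_sum:
  assumes C: "C \<in> carrier_mat n n" and r: "r < n"
    and J: "finite J" "J \<noteq> {}" "inj_on f J" "f ` J \<subseteq> {..<n}"
  shows "(\<Sum>j\<in>J. Re (C $$ (r, f j))) / sqrt (card J) \<le> hs_norm C"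
proof -
  have "(\<Sum>j\<in>J. Re (C $$ (r, f j)))\<^sup>2 \<le> card J * (\<Sum>j\<in>J. (Re (C $$ (r, f j)))\<^sup>2)"
    using sum_squared_le_sum_of_squares[of "\<lambda>j. Re (C $$ (r, f j))" J] J by (simp add: mult.commute)
  also have "(\<Sum>j\<in>J. (Re (C $$ (r, f j)))\<^sup>2) \<le> (\<Sum>j\<in>J. (cmod (C $$ (r, f j)))\<^sup>2)"
    by (intro sum_mono) (simp add: cmod_power2)
  also have "\<dots> = (\<Sum>i\<in>f ` J. (cmod (C $$ (r, i)))\<^sup>2)"
    using J by (simp add: sum.reindex)
  also have "\<dots> \<le> (\<Sum>i<n. (cmod (C $$ (r, i)))\<^sup>2)"
    using J by (intro sum_mono2) auto
  also have "\<dots> \<le> (\<Sum>i<n. \<Sum>j<n. (cmod (C $$ (j, i)))\<^sup>2)"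
    using r by (intro sum_mono member_le_sum) auto
  also have "\<dots> = (hs_norm C)\<^sup>2"
    unfolding hs_norm_alt[OF C] by (simp add: sum_nonneg)
  finally have "(\<Sum>j\<in>J. Re (C $$ (r, f j)))\<^sup>2 \<le> card J * (hs_norm C)\<^sup>2"
    by (simp add: mult_left_mono)
  also have "\<dots> = (sqrt (card J) * hs_norm C)\<^sup>2" by (simp add: power_mult_distrib)
  finally have "(\<Sum>j\<in>J. Re (C $$ (r, f j)))\<^sup>2 \<le> (sqrt (card J) * hs_norm C)\<^sup>2" .
  moreover have "0 \<le> sqrt (card J) * hs_norm C"
    unfolding hs_norm_alt[OF C] by (simp add: sum_nonneg)
  ultimately have "(\<Sum>j\<in>J. Re (C $$ (r, f j))) \<le> sqrt (card J) * hs_norm C"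
    by (rule power2_le_imp_le)
  moreover have "0 < sqrt (card J)" using J by (simp add: card_gt_0_iff)
  ultimately show ?thesis by (simp add: divide_le_eq mult.commute)
qed

text \<open>\<open>i * d + i\<close> is the index of the two-letter word \<open>ii\<close>, that is,
  of the basis vector \<open>e_i\<close> tensor \<open>e_i\<close>.\<close>

lemma diag_index_less:
  fixes d i :: nat
  assumes "i < d"
  shows "i * d + i < d ^ 2"
proof -
  have "(i + 1) * d \<le> d * d" using assms by (intro mult_le_mono1) simp
  then show ?thesis using assms by (simp add: power2_eq_square)
qed

lemma l2_norm_sq: "(l2_norm u)\<^sup>2 = (\<Sum>i<dim_vec u. (cmod (u $ i))\<^sup>2)"
proof -
  have "Re (u \<bullet>c u) = (\<Sum>i<dim_vec u. (cmod (u $ i))\<^sup>2)"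
    by (auto simp: scalar_prod_def lessThan_atLeast0 cmod_power2 sum.distrib
      power2_eq_square[of "Re z" for z] power2_eq_square[of "Im z" for z] intro!: sum.cong)
  then show ?thesis by (simp add: l2_norm_def sum_nonneg)
qed

lemma SEP_H2_row_sum_le:
  assumes d: "2 \<le> d" and \<tau>: "\<tau> \<in> SEP_H2 d"
  shows "(\<Sum>i\<in>{1..<d}. Re (\<tau> $$ (0, i * d + i))) \<le> 1 / 4"
proof -
  let ?S = "{mat_kron (ket_bra u) (ket_bra u) |u. u \<in> carrier_vec d \<and> l2_norm u = 1}"
  obtain T w where T: "finite T" "T \<subseteq> ?S" "\<forall>A\<in>T. 0 \<le> w A" "sum w T = (1::real)"
    and \<tau>_eq: "\<tau> = mat (d ^ 2) (d ^ 2) (\<lambda>(i, j). \<Sum>A\<in>T. of_real (w A) * A $$ (i, j))"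
    using \<tau> unfolding SEP_H2_def mat_convex_hull_def by blast
  \<comment> \<open>The witness is real-linear, so it is enough to bound it on the product states
    that span the hull.\<close>
  have A: "(\<Sum>i\<in>{1..<d}. Re (A $$ (0, i * d + i))) \<le> 1 / 4" if A_in: "A \<in> T" for A
  proof -
    obtain u where u: "u \<in> carrier_vec d" "l2_norm u = 1" "A = mat_kron (ket_bra u) (ket_bra u)"
      using T(2) A_in by blast
    have entry: "A $$ (0, i * d + i) = (u $ 0 * cnj (u $ i))\<^sup>2" if "i < d" for i
      using u that d diag_index_less[OF that]
      by (simp add: mat_kron_def ket_bra_def power2_eq_square)
    have "Re (A $$ (0, i * d + i)) \<le> (cmod (u $ 0))\<^sup>2 * (cmod (u $ i))\<^sup>2" if "i < d" for i
      using complex_Re_le_cmod[of "A $$ (0, i * d + i)"]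
      by (simp add: entry[OF that] norm_power norm_mult power_mult_distrib)
    then have "(\<Sum>i\<in>{1..<d}. Re (A $$ (0, i * d + i)))
        \<le> (\<Sum>i\<in>{1..<d}. (cmod (u $ 0))\<^sup>2 * (cmod (u $ i))\<^sup>2)"
      by (intro sum_mono) simp
    also have "\<dots> = (cmod (u $ 0))\<^sup>2 * (1 - (cmod (u $ 0))\<^sup>2)"
    proof -
      have "{..<d} = insert 0 {1..<d}" using d by auto
      then have "(\<Sum>i<d. (cmod (u $ i))\<^sup>2) = (cmod (u $ 0))\<^sup>2 + (\<Sum>i\<in>{1..<d}. (cmod (u $ i))\<^sup>2)"
        by simp
      then show ?thesis using l2_norm_sq[of u] u by (simp add: sum_distrib_left[symmetric])
    qed
    \<comment> \<open>With \<open>p = (cmod (u $ 0))\<^sup>2\<close>, the value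
      \<open>p * (1 - p)\<close> equals 1/4 minus the square of \<open>p - 1/2\<close>.\<close>
    also have "\<dots> \<le> 1 / 4"
      using zero_le_power2[of "(cmod (u $ 0))\<^sup>2 - 1 / 2"]
      by (simp add: power2_eq_square algebra_simps)
    finally show ?thesis .
  qed
  have "(\<Sum>i\<in>{1..<d}. Re (\<tau> $$ (0, i * d + i))) = (\<Sum>i\<in>{1..<d}. \<Sum>A\<in>T. w A * Re (A $$ (0, i * d + i)))"
    using d by (intro sum.cong refl) (simp add: \<tau>_eq diag_index_less)
  also have "\<dots> = (\<Sum>A\<in>T. w A * (\<Sum>i\<in>{1..<d}. Re (A $$ (0, i * d + i))))"
    by (subst sum.swap) (simp add: sum_distrib_left)
  also have "\<dots> \<le> (\<Sum>A\<in>T. w A * (1 / 4))"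
    using A T(3) by (intro sum_mono mult_left_mono) auto
  also have "\<dots> = 1 / 4" using T(4) by (simp add: sum_divide_distrib[symmetric])
  finally show ?thesis .
qed

section \<open>The bosonic pure state\<close>

lemma ket_bra_density_ops:
  assumes \<psi>: "\<psi> \<in> carrier_vec n" and norm: "(\<Sum>i<n. (cmod (\<psi> $ i))\<^sup>2) = 1"
    and V: "\<And>c. c \<cdot>\<^sub>v \<psi> \<in> V"
  shows "ket_bra \<psi> \<in> density_ops n V"
proof -
  have dim: "dim_vec \<psi> = n" using \<psi> by simp
  \<comment> \<open>The range consists of multiples of \<open>\<psi>\<close>, which is why
    \<open>V\<close> is only asked to contain those. The quadratic form becomes a number times its
    conjugate.\<close>
  have mv: "ket_bra \<psi> *\<^sub>v v = (v \<bullet>c \<psi>) \<cdot>\<^sub>v \<psi>" if "v \<in> carrier_vec n" for v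
    using that dim
    by (intro eq_vecI) (auto simp: ket_bra_def scalar_prod_def sum_distrib_right sum_distrib_left
        intro!: sum.cong)
  have "mat_adjoint (ket_bra \<psi>) = ket_bra \<psi>"
    by (rule eq_matI) (auto simp: mat_adjoint_def ket_bra_def mat_of_rows_def)
  moreover have "0 \<le> Re ((ket_bra \<psi> *\<^sub>v v) \<bullet>c v)" if v: "v \<in> carrier_vec n" for v
  proof -
    have c: "\<psi> \<bullet>c v = cnj (v \<bullet>c \<psi>)"
      using v dim by (auto simp: scalar_prod_def mult.commute intro!: sum.cong)
    have "(ket_bra \<psi> *\<^sub>v v) \<bullet>c v = (v \<bullet>c \<psi>) * (\<psi> \<bullet>c v)"
      unfolding mv[OF v] using v \<psi> by simp
    then show ?thesis unfolding c by simp
  qed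
  moreover have "mat_trace (ket_bra \<psi>) = 1"
  proof -
    have "mat_trace (ket_bra \<psi>) = (\<Sum>i<n. of_real ((cmod (\<psi> $ i))\<^sup>2))"
      unfolding mat_trace_def using dim
      by (auto simp: ket_bra_def complex_norm_square[symmetric] intro!: sum.cong)
    also have "\<dots> = of_real 1" unfolding norm[symmetric] by simp
    finally show ?thesis by simp
  qed
  ultimately show ?thesis
    using \<psi> V mv dim by (auto simp: density_ops_def ket_bra_def)
qed

text \<open>
  Both word classes get equal weight because the entries \<open>(00, ii)\<close> of the marginal are the
  interference terms between them: replacing the pair \<open>00\<close> by \<open>ii\<close> lowers the number of
  zeros by 2.
\<close>

definition two_level_vec :: "nat \<Rightarrow> nat \<Rightarrow> nat \<Rightarrow> nat \<Rightarrow> complex vec" where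
  "two_level_vec d N z z' = vec (d ^ N) (\<lambda>n. complex_of_real
     (if n \<in> flat_index d N ` even_words d N z then 1 / sqrt (2 * card (even_words d N z))
      else if n \<in> flat_index d N ` even_words d N z' then 1 / sqrt (2 * card (even_words d N z'))
      else 0))"

lemma flat_index_words_less: "a \<in> words d N \<Longrightarrow> flat_index d N a < d ^ N"
  by (rule flat_index_less) (rule words_less)

lemma two_level_vec_symmetric: "c \<cdot>\<^sub>v two_level_vec d N z z' \<in> sym_subspace d N"
  unfolding sym_subspace_def
proof safe
  show "c \<cdot>\<^sub>v two_level_vec d N z z' \<in> carrier_vec (d ^ N)" by (simp add: two_level_vec_def)
next
  fix a \<pi> assume a: "\<forall>k<N. a k < d" and \<pi>: "\<pi> permutes {..<N}"
  have "flat_index d N (a \<circ> \<pi>) < d ^ N"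
    using a permutes_in_image[OF \<pi>] by (intro flat_index_less) auto
  moreover have "flat_index d N a < d ^ N" using a by (intro flat_index_less) auto
  ultimately show "(c \<cdot>\<^sub>v two_level_vec d N z z') $ flat_index d N (a \<circ> \<pi>) =
      (c \<cdot>\<^sub>v two_level_vec d N z z') $ flat_index d N a"
    using a by (simp add: two_level_vec_def flat_index_even_words_permutes[OF _ \<pi>])
qed

lemma two_level_vec_index:
  assumes "z \<noteq> z'"
  shows "a \<in> even_words d N z \<Longrightarrow>
      two_level_vec d N z z' $ flat_index d N a = of_real (1 / sqrt (2 * card (even_words d N z)))"
    and "a \<in> even_words d N z' \<Longrightarrow>
      two_level_vec d N z z' $ flat_index d N a = of_real (1 / sqrt (2 * card (even_words d N z')))"
proof -
  have less: "flat_index d N a < d ^ N" if "a \<in> even_words d N y" for y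
    using that even_words_subset flat_index_words_less by blast
  show "two_level_vec d N z z' $ flat_index d N a = of_real (1 / sqrt (2 * card (even_words d N z)))"
    if "a \<in> even_words d N z"
    using that less[OF that] by (simp add: two_level_vec_def)
  show "two_level_vec d N z z' $ flat_index d N a = of_real (1 / sqrt (2 * card (even_words d N z')))"
    if a: "a \<in> even_words d N z'"
  proof -
    \<comment> \<open>The definition tests class \<open>z\<close> first, so an index from class
      \<open>z'\<close> reaches the second branch only because the classes are disjoint.\<close>
    have "a \<notin> even_words d N z" using even_words_disjoint[OF assms] a by blast
    then have "flat_index d N a \<notin> flat_index d N ` even_words d N z"
      using inj_on_image_mem_iff[OF inj_on_flat_index _ even_words_subset] a even_words_subset by blast
    then show ?thesis using a less[OF a] by (simp add: two_level_vec_def)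
  qed
qed

lemma two_level_vec_norm:
  assumes "z \<noteq> z'" "even_words d N z \<noteq> {}" "even_words d N z' \<noteq> {}"
  shows "(\<Sum>i<d ^ N. (cmod (two_level_vec d N z z' $ i))\<^sup>2) = 1"
proof -
  let ?F = "flat_index d N" and ?v = "two_level_vec d N z z'"
  let ?A = "even_words d N z" and ?B = "even_words d N z'"
  have disj: "?A \<inter> ?B = {}" using even_words_disjoint assms(1) .
  have fin: "finite ?A" "finite ?B" by (rule finite_even_words)+
  have inj: "inj_on ?F (?A \<union> ?B)"
    using inj_on_flat_index by (rule inj_on_subset) (use even_words_subset in blast)
  have "(\<Sum>i<d ^ N. (cmod (?v $ i))\<^sup>2) = (\<Sum>i\<in>?F ` (?A \<union> ?B). (cmod (?v $ i))\<^sup>2)"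
  proof (rule sum.mono_neutral_right)
    show "?F ` (?A \<union> ?B) \<subseteq> {..<d ^ N}" using even_words_subset flat_index_words_less by blast
    show "\<forall>i\<in>{..<d ^ N} - ?F ` (?A \<union> ?B). (cmod (?v $ i))\<^sup>2 = 0"
      by (auto simp: two_level_vec_def image_Un)
  qed simp
  also have "\<dots> = (\<Sum>a\<in>?A \<union> ?B. (cmod (?v $ ?F a))\<^sup>2)"
    using inj by (simp add: sum.reindex)
  also have "\<dots> = (\<Sum>a\<in>?A. (cmod (?v $ ?F a))\<^sup>2) + (\<Sum>a\<in>?B. (cmod (?v $ ?F a))\<^sup>2)"
    using disj fin by (intro sum.union_disjoint)
  \<comment> \<open>Each class carries total weight 1/2.\<close>
  also have "\<dots> = (\<Sum>a\<in>?A. 1 / (2 * real (card ?A))) + (\<Sum>a\<in>?B. 1 / (2 * real (card ?B)))"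
    by (intro arg_cong2[of _ _ _ _ "(+)"] sum.cong refl)
      (simp_all add: two_level_vec_index[OF assms(1)] norm_divide power_divide)
  also have "\<dots> = 1" using assms fin by simp
  finally show ?thesis .
qed

section \<open>The marginal on the first two tensor factors\<close>

lemma flat_index_two: "flat_index d 2 a = a 0 * d + a 1"
  by (simp add: flat_index_def numeral_2_eq_2)

text \<open>The entry sums, over all tails, the amplitude of 00 followed by the tail times the
  conjugate amplitude of \<open>ii\<close> followed by the same tail. Each word of class
  \<open>z\<close> starting with 00 supplies one such tail, and its partner lies in class
  \<open>z - 2\<close>.\<close>

lemma two_level_marginal_entry_ge:
  assumes N: "2 \<le> N" and z: "2 \<le> z" and i: "0 < i" "i < d"
  shows "real (card {a\<in>even_words d N z. a 0 = 0 \<and> a 1 = 0}) /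
      (2 * sqrt (real (card (even_words d N z)) * real (card (even_words d N (z - 2)))))
    \<le> Re (partial_trace (d ^ 2) (d ^ (N - 2)) (ket_bra (two_level_vec d N z (z - 2))) $$ (0, i * d + i))"
proof -
  let ?F = "flat_index d N" and ?v = "two_level_vec d N z (z - 2)"
  let ?A = "even_words d N z" and ?B = "even_words d N (z - 2)"
  let ?n = "d ^ (N - 2)" and ?Z = "{a\<in>even_words d N z. a 0 = 0 \<and> a 1 = 0}"
  have zz: "z \<noteq> z - 2" using z by simp
  have dN: "d ^ N = d ^ 2 * ?n" using N by (metis power_add le_add_diff_inverse)
  have split: "?F a = (a 0 * d + a 1) * ?n + flat_index d (N - 2) (\<lambda>k. a (2 + k))" for a
    using flat_index_split[of d 2 "N - 2" a] unfolding le_add_diff_inverse[OF N] flat_index_two .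
  have bound: "p * ?n + k < d ^ N" if "p < d ^ 2" "k < ?n" for p k
  proof -
    have "(p + 1) * ?n \<le> d ^ 2 * ?n" using that by (intro mult_le_mono1) simp
    then show ?thesis using that dN by simp
  qed
  have nonneg: "0 \<le> Re (?v $ p)" "Im (?v $ p) = 0" if "p < d ^ N" for p
    using that by (simp_all add: two_level_vec_def)
  have entry: "Re (partial_trace (d ^ 2) ?n (ket_bra ?v) $$ (0, i * d + i)) =
      (\<Sum>k<?n. Re (?v $ k) * Re (?v $ ((i * d + i) * ?n + k)))"
  proof -
    have "0 < d ^ 2" using i by simp
    then have eq: "partial_trace (d ^ 2) ?n (ket_bra ?v) $$ (0, i * d + i) =
        (\<Sum>k<?n. ?v $ k * cnj (?v $ ((i * d + i) * ?n + k)))"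
      using diag_index_less[OF i(2)] bound[of 0] bound[OF diag_index_less[OF i(2)]]
      by (auto simp: partial_trace_def ket_bra_def two_level_vec_def intro!: sum.cong)
    show ?thesis
      unfolding eq using nonneg(2) bound[of 0] bound[OF diag_index_less[OF i(2)]] \<open>0 < d ^ 2\<close>
      by simp
  qed
  have inj: "inj_on ?F ?Z"
    using inj_on_flat_index by (rule inj_on_subset) (use even_words_subset in blast)
  \<comment> \<open>The leading letters 00 contribute nothing, so the index of the word is the index
    of its tail.\<close>
  have small: "?F a < ?n" if "a \<in> ?Z" for a
  proof -
    have w: "a \<in> words d N" using that even_words_subset by blast
    have "flat_index d (N - 2) (\<lambda>k. a (2 + k)) < ?n"
      using N by (intro flat_index_less) (auto intro!: words_less[OF w])
    then show ?thesis using that by (simp add: split[of a])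
  qed
  have "real (card ?Z) / (2 * sqrt (real (card ?A) * real (card ?B))) =
      (\<Sum>a\<in>?Z. 1 / (2 * sqrt (real (card ?A) * real (card ?B))))" by simp
  also have "\<dots> = (\<Sum>a\<in>?Z. Re (?v $ ?F a) * Re (?v $ ((i * d + i) * ?n + ?F a)))"
  proof (rule sum.cong[OF refl])
    fix a assume a: "a \<in> ?Z"
    let ?a = "a(0 := i, 1 := i)"
    have "?a \<in> ?B" using a i N by (intro even_words_raise) auto
    moreover have "?F ?a = (i * d + i) * ?n + ?F a"
      using a split[of ?a] split[of a] by simp
    ultimately have "?v $ ((i * d + i) * ?n + ?F a) = of_real (1 / sqrt (2 * card ?B))"
      using two_level_vec_index(2)[OF zz, of ?a d N] by simp
    moreover have "?v $ ?F a = of_real (1 / sqrt (2 * card ?A))"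
      using two_level_vec_index(1)[OF zz, of a d N] a by simp
    ultimately show "1 / (2 * sqrt (real (card ?A) * real (card ?B))) =
        Re (?v $ ?F a) * Re (?v $ ((i * d + i) * ?n + ?F a))"
      by (simp add: real_sqrt_mult)
  qed
  also have "\<dots> = (\<Sum>k\<in>?F ` ?Z. Re (?v $ k) * Re (?v $ ((i * d + i) * ?n + k)))"
    using inj by (simp add: sum.reindex)
  \<comment> \<open>All amplitudes are nonnegative, so admitting the remaining tails cannot decrease
    the sum.\<close>
  also have "\<dots> \<le> (\<Sum>k<?n. Re (?v $ k) * Re (?v $ ((i * d + i) * ?n + k)))"
  proof (rule sum_mono2)
    show "?F ` ?Z \<subseteq> {..<?n}" using small by auto
    fix k assume "k \<in> {..<?n} - ?F ` ?Z"
    then have "k < ?n" by simp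
    moreover have "0 < d ^ 2" using i by simp
    ultimately have "k < d ^ N" "(i * d + i) * ?n + k < d ^ N"
      using bound[of 0 k] bound[OF diag_index_less[OF i(2)]] by auto
    then show "0 \<le> Re (?v $ k) * Re (?v $ ((i * d + i) * ?n + k))"
      using nonneg by simp
  qed simp
  finally show ?thesis unfolding entry .
qed

section \<open>Choice of parameters and the final estimate\<close>

lemma BOS2_row_sum_ge:
  assumes N: "4 \<le> N" and d: "d = 12 * N + 1"
  obtains \<rho> where "\<rho> \<in> BOS2 N d" "(\<Sum>i\<in>{1..<d}. Re (\<rho> $$ (0, i * d + i))) \<ge> 1 / 2"
proof -
  \<comment> \<open>Both \<open>z\<close> and \<open>N - (z - 2)\<close> are then at least
    \<open>N / 2\<close>, and \<open>z\<close> has the parity of \<open>N\<close>, as a word with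
    evenly many nonzero letters requires.\<close>
  define z where "z = N - 2 * (N div 4)"
  have z: "2 \<le> z" "z \<le> N" "N \<le> 2 * z" "N \<le> 2 * (N - (z - 2))"
    using N by (auto simp: z_def)
  define m where "m = card (even_words d N z)"
  define n where "n = card (even_words d N (z - 2))"
  define e where "e = card {a\<in>even_words d N z. a 0 = 0 \<and> a 1 = 0}"
  have A: "even_words d N z \<noteq> {}"
    unfolding z_def by (rule even_words_nonempty) (use d N in auto)
  have "z - 2 = N - 2 * (N div 4 + 1)" by (simp add: z_def)
  then have B: "even_words d N (z - 2) \<noteq> {}"
    using even_words_nonempty[of "N div 4 + 1" N d] d N by simp
  have mn: "0 < m" "0 < n" using A B finite_even_words by (auto simp: m_def n_def card_gt_0_iff)
  have h1: "N * (N - 1) * e = z * (z - 1) * m"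
    unfolding e_def m_def by (rule card_even_words_zero_pair)
  \<comment> \<open>The class \<open>z - 2\<close> has \<open>(d - 1) * e\<close> words that start
    with an equal nonzero pair, and here \<open>d - 1\<close> is \<open>12 * N\<close>.\<close>
  have h2: "(N - (z - 2)) * n \<le> N * (N - 1) * (12 * N * e)"
    using card_even_words_equal_pair[of N "z - 2" d] card_even_words_exchange[of N z d] z N
    by (simp add: n_def e_def d)
  have NN: "0 < N * (N - 1)" using N by simp
  have e1: "m \<le> 6 * e"
  proof -
    have "N * (N - 1) \<le> 6 * (z * (z - 1))"
    proof -
      \<comment> \<open>The factor 3 is attained at \<open>N = 4\<close>, where
        \<open>z = 2\<close>.\<close>
      have "N \<le> 2 * z" "N - 1 \<le> 3 * (z - 1)" using z N by auto
      then have "N * (N - 1) \<le> (2 * z) * (3 * (z - 1))" by (rule mult_le_mono)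
      then show ?thesis by simp
    qed
    then have "N * (N - 1) * m \<le> 6 * (z * (z - 1)) * m" by (rule mult_le_mono1)
    also have "\<dots> = N * (N - 1) * (6 * e)" using h1 by simp
    finally show ?thesis using NN by simp
  qed
  have e2: "n \<le> 2 * N * (12 * N * e)"
  proof -
    have "N * (N - 1) * n \<le> N * (2 * (N - (z - 2))) * n"
      using z(4) by (intro mult_le_mono) auto
    also have "\<dots> = 2 * N * ((N - (z - 2)) * n)" by simp
    also have "\<dots> \<le> 2 * N * (N * (N - 1) * (12 * N * e))" using h2 by (rule mult_le_mono2)
    also have "\<dots> = N * (N - 1) * (2 * N * (12 * N * e))" by (simp only: mult_ac)
    finally show ?thesis using NN by simp
  qed
  \<comment> \<open>The two bounds give \<open>m * n <= 12 * N * (d - 1) * e\<^sup>2\<close>. Taking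
    \<open>d - 1 = 12 * N\<close> makes the right side a perfect square and the resulting bound on
    the witness exactly 1/2.\<close>
  have "2 * N * (m * n) \<le> 2 * N * (6 * e * (2 * N * (12 * N * e)))"
    using e1 e2 by (intro mult_le_mono) auto
  also have "\<dots> = 2 * N * (12 * N * e) ^ 2" by (simp add: power2_eq_square)
  finally have "m * n \<le> (12 * N * e) ^ 2" using N by simp
  then have "real m * real n \<le> (real (12 * N * e)) ^ 2"
    by (metis of_nat_le_iff of_nat_mult of_nat_power)
  then have sq: "sqrt (real m * real n) \<le> real (12 * N * e)"
    by (rule real_le_lsqrt[rotated]) simp
  let ?\<rho> = "partial_trace (d ^ 2) (d ^ (N - 2)) (ket_bra (two_level_vec d N z (z - 2)))"
  show thesis
  proof (rule that[of ?\<rho>])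
    have "ket_bra (two_level_vec d N z (z - 2)) \<in> density_ops (d ^ N) (sym_subspace d N)"
      using two_level_vec_norm[OF _ A B] z
      by (intro ket_bra_density_ops two_level_vec_symmetric) (auto simp: two_level_vec_def)
    then show "?\<rho> \<in> BOS2 N d" unfolding BOS2_def by blast
    have "1 / 2 \<le> real (12 * N) * (real e / (2 * sqrt (real m * real n)))"
      using sq mn by (simp add: field_simps)
    also have "\<dots> = (\<Sum>i\<in>{1..<d}. real e / (2 * sqrt (real m * real n)))" by (simp add: d)
    also have "\<dots> \<le> (\<Sum>i\<in>{1..<d}. Re (?\<rho> $$ (0, i * d + i)))"
      unfolding e_def m_def n_def
      using two_level_marginal_entry_ge[of N z _ d] z N by (intro sum_mono) auto
    finally show "1 / 2 \<le> (\<Sum>i\<in>{1..<d}. Re (?\<rho> $$ (0, i * d + i)))" .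
  qed
qed

theorem theoremB6:
  shows "\<exists>c>0. \<exists>N0::nat. \<forall>N\<ge>N0.
    (SUP d\<in>{2..}. SUP \<rho>\<in>BOS2 N d. INF \<tau>\<in>SEP_H2 d. ereal (hs_norm (\<rho> - \<tau>)))
      \<ge> ereal (c * real N powr (- 1 / 2))"
proof (intro exI[of _ "1 / (4 * sqrt 12)"] conjI exI[of _ "4::nat"] allI impI)
  fix N :: nat assume N: "4 \<le> N"
  define d where "d = 12 * N + 1"
  obtain \<rho> where \<rho>: "\<rho> \<in> BOS2 N d" "(\<Sum>i\<in>{1..<d}. Re (\<rho> $$ (0, i * d + i))) \<ge> 1 / 2"
    using BOS2_row_sum_ge[OF N d_def] .
  have d2: "2 \<le> d" using N by (simp add: d_def)
  have dist: "1 / (4 * sqrt 12) * real N powr (- 1 / 2) \<le> hs_norm (\<rho> - \<tau>)"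
    if \<tau>: "\<tau> \<in> SEP_H2 d" for \<tau>
  proof -
    have car: "\<tau> \<in> carrier_mat (d ^ 2) (d ^ 2)" "\<rho> \<in> carrier_mat (d ^ 2) (d ^ 2)"
      using \<tau> \<rho>(1) by (auto simp: SEP_H2_def mat_convex_hull_def BOS2_def partial_trace_def)
    have d0: "0 < d ^ 2" using d2 by simp
    have "(\<Sum>i\<in>{1..<d}. Re ((\<rho> - \<tau>) $$ (0, i * d + i))) / sqrt (card {1..<d}) \<le> hs_norm (\<rho> - \<tau>)"
    proof (rule hs_norm_ge_row_sum)
      show "\<rho> - \<tau> \<in> carrier_mat (d ^ 2) (d ^ 2)" using car by (simp add: minus_carrier_mat)
      \<comment> \<open>The factor \<open>d + 1\<close> is nonzero and can be cancelled.\<close>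
      have "i * d + i = i * (d + 1)" for i by simp
      then show "inj_on (\<lambda>i. i * d + i) {1..<d}" by (intro inj_onI) 
          (metis mult_cancel2 Suc_eq_plus1 nat.distinct(1))
      show "(\<lambda>i. i * d + i) ` {1..<d} \<subseteq> {..<d ^ 2}" using diag_index_less by auto
    qed (use d0 d2 in auto)
    moreover have "(\<Sum>i\<in>{1..<d}. Re ((\<rho> - \<tau>) $$ (0, i * d + i))) =
        (\<Sum>i\<in>{1..<d}. Re (\<rho> $$ (0, i * d + i))) - (\<Sum>i\<in>{1..<d}. Re (\<tau> $$ (0, i * d + i)))"
      unfolding sum_subtractf[symmetric] using car d0 diag_index_less by (intro sum.cong) auto
    \<comment> \<open>The gap between 1/2 for the bosonic marginal and 1/4 for separable
      states.\<close>
    moreover have "\<dots> \<ge> 1 / 4" using \<rho>(2) SEP_H2_row_sum_le[OF d2 \<tau>] by simp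
    ultimately have "(1 / 4) / sqrt (card {1..<d}) \<le> hs_norm (\<rho> - \<tau>)"
      by (smt (verit) divide_right_mono of_nat_0_le_iff real_sqrt_ge_zero)
    \<comment> \<open>The row sum has \<open>d - 1 = 12 * N\<close> terms, which yields both the
      constant and the rate.\<close>
    moreover have "(1 / 4) / sqrt (card {1..<d}) = 1 / (4 * sqrt 12) * real N powr (- 1 / 2)"
      using N by (simp add: d_def real_sqrt_mult powr_minus_divide powr_half_sqrt)
    ultimately show ?thesis by simp
  qed
  have "ereal (1 / (4 * sqrt 12) * real N powr (- 1 / 2)) \<le> (INF \<tau>\<in>SEP_H2 d. ereal (hs_norm (\<rho> - \<tau>)))"
    using dist by (intro INF_greatest) simp
  then show "ereal (1 / (4 * sqrt 12) * real N powr (- 1 / 2)) \<le>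
      (SUP d\<in>{2..}. SUP \<rho>\<in>BOS2 N d. INF \<tau>\<in>SEP_H2 d. ereal (hs_norm (\<rho> - \<tau>)))"
    using d2 \<rho>(1) by (intro SUP_upper2[of d] SUP_upper2[of \<rho>]) auto
qed simp

end
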